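(* Let $n\in\mathbb{N}$, let $S$ be any finite generating set of $\mathbb{Z}^n$ and let $\varphi\in\operatorname{End}(\mathbb{Z}^n)$. Then the twisted conjugacy growth function $f_R^S$ of $\varphi$ with respect to $S$ satisfies $$f_R^S(r)=\Theta\big(r^{\,n-\operatorname{rank}(\operatorname{Id}_{\mathbb{Z}^n}-\varphi)}\big)\quad\text{as } r\to\infty.$$
   Context: For a group $G$ with finite generating set $S$, the word length $|g|_S$ of $g\in G$ is the minimal $k\in\mathbb{N}=\{0,1,2,\dots\}$ such that $g=s_1\cdots s_k$ with $s_i\in S\cup S^{-1}$, and $B_G^S(r)=\{g\in G : |g|_S\le r\}$ for $r\in\mathbb{R}_{\ge 0}$. For $\varphi\in\operatorname{End}(G)$, elements $g,h\in G$ are $\varphi$-twisted conjugate ($g\sim_\varphi h$) if there is $z\in G$ with $g=zh\varphi(z)^{-1}$. This is an equivalence relation; the class of $g$ is denoted $[g]_\varphi$. The twisted conjugacy growth function of $\varphi$ with respect to $S$ is $f_R^S(r)=\#\{[g]_\varphi : g\in B_G^S(r)\}$ for $r\in\mathbb{R}_{\ge 0}$. The rank of an endomorphism of a free abelian group of finite rank is the rank of its image. For non-negative functions $f,g$, $f(r)=\Theta(g(r))$ as $r\to\infty$ means that there are $c_1,c_2>0$ and $n_0\in\mathbb{N}_{>0}$ such that $c_1g(r)\le f(r)\le c_2g(r)$ for all $r\ge n_0$. *)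

theory Defs
  imports "HOL-Algebra.Algebra" "HOL-Library.Landau_Symbols"
begin

(* \<open>product_group\<close> consists of extensional functions, so the case n = 0 is the trivial group. *)
definition Z_pow :: "nat \<Rightarrow> (nat \<Rightarrow> int) monoid"
  where "Z_pow n = product_group {..<n} (\<lambda>_. integer_group)"

definition fin_gen_set :: "('a, 'b) monoid_scheme \<Rightarrow> 'a set \<Rightarrow> bool"
  where "fin_gen_set G S \<longleftrightarrow> finite S \<and> S \<subseteq> carrier G \<and> generate G S = carrier G"

(* Only meaningful for elements of the subgroup generated by S;
   otherwise \<open>LEAST\<close> is taken over an empty set. *)
definition word_length :: "('a, 'b) monoid_scheme \<Rightarrow> 'a set \<Rightarrow> 'a \<Rightarrow> nat"
  where "word_length G S g =
    (LEAST k. \<exists>w. length w = k \<and> set w \<subseteq> S \<union> m_inv G ` S \<and> foldr (\<otimes>\<^bsub>G\<^esub>) w \<one>\<^bsub>G\<^esub> = g)"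

definition word_ball :: "('a, 'b) monoid_scheme \<Rightarrow> 'a set \<Rightarrow> real \<Rightarrow> 'a set"
  where "word_ball G S r = {g \<in> carrier G. real (word_length G S g) \<le> r}"

definition twisted_conj :: "('a, 'b) monoid_scheme \<Rightarrow> ('a \<Rightarrow> 'a) \<Rightarrow> 'a \<Rightarrow> 'a \<Rightarrow> bool"
  where "twisted_conj G \<phi> g h \<longleftrightarrow>
    (\<exists>z \<in> carrier G. g = z \<otimes>\<^bsub>G\<^esub> h \<otimes>\<^bsub>G\<^esub> inv\<^bsub>G\<^esub> (\<phi> z))"

definition twisted_class :: "('a, 'b) monoid_scheme \<Rightarrow> ('a \<Rightarrow> 'a) \<Rightarrow> 'a \<Rightarrow> 'a set"
  where "twisted_class G \<phi> g = {h \<in> carrier G. twisted_conj G \<phi> g h}"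

(* \<open>card\<close> is the true number of classes here because balls are finite for finite S. *)
definition twisted_growth :: "('a, 'b) monoid_scheme \<Rightarrow> 'a set \<Rightarrow> ('a \<Rightarrow> 'a) \<Rightarrow> real \<Rightarrow> nat"
  where "twisted_growth G S \<phi> r = card (twisted_class G \<phi> ` word_ball G S r)"

definition free_abelian_rank :: "('a, 'b) monoid_scheme \<Rightarrow> nat"
  where "free_abelian_rank G = (THE k. G \<cong> free_Abelian_group {..<k})"

lemma free_abelian_rank_eqI:
  assumes "group G" "G \<cong> free_Abelian_group {..<k}"
  shows "free_abelian_rank G = k"
  unfolding free_abelian_rank_def
proof (rule the_equality)
  fix l :: nat assume "G \<cong> free_Abelian_group {..<l}"
  then have "free_Abelian_group {..<l} \<cong> free_Abelian_group {..<k}"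
    using assms group.iso_sym iso_trans by blast
  then show "l = k"
    by (simp add: isomorphic_free_Abelian_groups eqpoll_iff_card)
qed (fact assms(2))

definition endo_rank :: "('a, 'b) monoid_scheme \<Rightarrow> ('a \<Rightarrow> 'a) \<Rightarrow> nat"
  where "endo_rank G \<psi> = free_abelian_rank (G\<lparr>carrier := \<psi> ` carrier G\<rparr>)"

(* The map Id - \<phi>, written multiplicatively; an endomorphism when G is abelian. *)
definition id_minus :: "('a, 'b) monoid_scheme \<Rightarrow> ('a \<Rightarrow> 'a) \<Rightarrow> 'a \<Rightarrow> 'a"
  where "id_minus G \<phi> = (\<lambda>x. x \<otimes>\<^bsub>G\<^esub> inv\<^bsub>G\<^esub> (\<phi> x))"

end

theory Submission
  imports Defs
begin

text \<open>
  In an abelian group $g = z + h - \varphi(z)$ says that $g$ and $h$ differ by a value of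
  $\mathrm{Id} - \varphi$, so the twisted conjugacy classes are the cosets of the subgroup
  $H = \mathrm{im}(\mathrm{Id} - \varphi)$ (lemma \<open>twisted_class_eq_coset\<close>), and the task is to count
  the cosets of $H$ that meet a ball. A ball of radius $r$ lies between two boxes whose side lengths
  are proportional to $r$ (lemmas \<open>ex_ball_in_box\<close> and \<open>ex_box_in_ball\<close>), so it suffices to count
  cosets that meet a box.

  The count uses integral Gaussian elimination. Call $i$ a pivot of $H$ if some $h \in H$ has its
  first nonzero coordinate at position $i$. Choosing for every pivot an $h$ whose leading
  coefficient is positive and minimal gives an echelon basis (lemma \<open>ex_echelon_basis\<close>). It is a
  $\mathbb{Z}$-basis of $H$, hence the rank of $H$ is its number of pivots
  (lemma \<open>free_abelian_rank_subgroup\<close>), and $m = n - \mathrm{rank}(H)$ coordinates are free.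

  For the upper bound, subtracting multiples of the basis vectors reduces every pivot coordinate
  modulo its leading coefficient, while the other coordinates grow at most by a constant factor. So
  each coset that meets a box of side $R$ has a representative with boundedly many choices in the
  pivot coordinates and $O(R)$ choices in each of the $m$ free ones
  (lemma \<open>card_cosets_box_upper\<close>). For the lower bound, two vectors that vanish at all pivots and
  differ by an element of $H$ are equal, because the leading position of a nonzero difference would
  be a pivot; such vectors alone give $(t+1)^m$ cosets that meet the box $[0,t]^n$
  (lemma \<open>card_cosets_box_lower\<close>).
\<close>

section \<open>Word length\<close>

lemma (in monoid) foldr_mult_closed:
  "set w \<subseteq> carrier G \<Longrightarrow> foldr (\<otimes>) w \<one> \<in> carrier G"
  by (induction w) auto

lemma (in monoid) foldr_mult_append:
  assumes "set v \<subseteq> carrier G" "set w \<subseteq> carrier G"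
  shows "foldr (\<otimes>) (v @ w) \<one> = foldr (\<otimes>) v \<one> \<otimes> foldr (\<otimes>) w \<one>"
  using assms by (induction v) (auto simp: foldr_mult_closed m_assoc simp del: foldr_append)

lemma (in group) letters_closed:
  "S \<subseteq> carrier G \<Longrightarrow> S \<union> m_inv G ` S \<subseteq> carrier G"
  by auto

lemma (in group) ex_word_of_generate:
  assumes "S \<subseteq> carrier G" "g \<in> generate G S"
  shows "\<exists>w. set w \<subseteq> S \<union> m_inv G ` S \<and> foldr (\<otimes>) w \<one> = g"
  using assms(2)
proof induction
  case one
  show ?case by (rule exI[of _ "[]"]) simp
next
  case (incl h)
  then show ?case using assms(1) by (intro exI[of _ "[h]"]) auto
next
  case (inv h)
  then show ?case using assms(1) by (intro exI[of _ "[inv h]"]) auto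
next
  case (eng h1 h2)
  then obtain v w where
    "set v \<subseteq> S \<union> m_inv G ` S" "foldr (\<otimes>) v \<one> = h1"
    "set w \<subseteq> S \<union> m_inv G ` S" "foldr (\<otimes>) w \<one> = h2" by blast
  then show ?case
    using letters_closed[OF assms(1)] foldr_mult_append[of v w]
    by (intro exI[of _ "v @ w"]) (simp add: subset_trans del: foldr_append)
qed

lemma (in group) word_length_attained:
  assumes "fin_gen_set G S" "g \<in> carrier G"
  obtains w where "length w = word_length G S g" "set w \<subseteq> S \<union> m_inv G ` S" "foldr (\<otimes>) w \<one> = g"
proof -
  obtain w where "set w \<subseteq> S \<union> m_inv G ` S" "foldr (\<otimes>) w \<one> = g"
    using assms ex_word_of_generate[of S g] unfolding fin_gen_set_def by auto
  then have "\<exists>k w. length w = k \<and> set w \<subseteq> S \<union> m_inv G ` S \<and> foldr (\<otimes>) w \<one> = g" by blast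
  from LeastI_ex[OF this] that show ?thesis unfolding word_length_def by blast
qed

lemma word_length_le:
  assumes "set w \<subseteq> S \<union> m_inv G ` S" "foldr (\<otimes>\<^bsub>G\<^esub>) w \<one>\<^bsub>G\<^esub> = g"
  shows "word_length G S g \<le> length w"
  unfolding word_length_def using assms by (intro Least_le) blast

lemma word_length_one: "word_length G S \<one>\<^bsub>G\<^esub> = 0"
  using word_length_le[of "[]" S G] by simp

lemma (in group) word_length_mult_le:
  assumes S: "fin_gen_set G S" and "x \<in> carrier G" "y \<in> carrier G"
  shows "word_length G S (x \<otimes> y) \<le> word_length G S x + word_length G S y"
proof -
  obtain v where v: "length v = word_length G S x" "set v \<subseteq> S \<union> m_inv G ` S" "foldr (\<otimes>) v \<one> = x"
    using word_length_attained[OF S assms(2)] .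
  obtain w where w: "length w = word_length G S y" "set w \<subseteq> S \<union> m_inv G ` S" "foldr (\<otimes>) w \<one> = y"
    using word_length_attained[OF S assms(3)] .
  have "S \<union> m_inv G ` S \<subseteq> carrier G"
    using S letters_closed by (simp add: fin_gen_set_def)
  then have "foldr (\<otimes>) (v @ w) \<one> = x \<otimes> y"
    using v w by (subst foldr_mult_append) auto
  then show ?thesis
    using word_length_le[of "v @ w" S G "x \<otimes> y"] v w by simp
qed

lemma (in group) word_length_pow_le:
  fixes k :: nat
  assumes "fin_gen_set G S" "x \<in> carrier G"
  shows "word_length G S (x [^] k) \<le> k * word_length G S x"
proof (induction k)
  case 0
  show ?case by (simp add: word_length_one)
next
  case (Suc k)
  show ?case
    using word_length_mult_le[OF assms(1) nat_pow_closed[OF assms(2), of k] assms(2)] Suc by simp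
qed

section \<open>Twisted conjugacy classes in an abelian group\<close>

lemma (in comm_group) id_minus_hom:
  assumes "\<phi> \<in> hom G G"
  shows "id_minus G \<phi> \<in> hom G G"
proof (rule homI)
  fix x y assume [simp]: "x \<in> carrier G" "y \<in> carrier G"
  have [simp]: "\<phi> x \<in> carrier G" "\<phi> y \<in> carrier G" using assms by (auto simp: hom_def)
  show "id_minus G \<phi> x \<in> carrier G" by (simp add: id_minus_def)
  show "id_minus G \<phi> (x \<otimes> y) = id_minus G \<phi> x \<otimes> id_minus G \<phi> y"
    using assms by (simp add: id_minus_def hom_mult inv_mult m_ac)
qed

lemma (in comm_group) subgroup_id_minus_image:
  assumes "\<phi> \<in> hom G G"
  shows "subgroup (id_minus G \<phi> ` carrier G) G"
  using group_hom.img_is_subgroup[of G G] id_minus_hom[OF assms]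
  by (simp add: group_hom_def group_hom_axioms_def is_group)

text \<open>
  Commutativity turns $z h \varphi(z)^{-1}$ into $(z \varphi(z)^{-1}) h$. Membership of $h$ in the class
  of $g$ expresses $g$ through $h$, and membership in the coset expresses $h$ through $g$; the
  homomorphism property lets one pass between the two by replacing $z$ with $z^{-1}$.
\<close>

lemma (in comm_group) twisted_class_eq_coset:
  assumes \<phi>: "\<phi> \<in> hom G G" and g: "g \<in> carrier G"
  shows "twisted_class G \<phi> g = (id_minus G \<phi> ` carrier G) #> g"
proof -
  have \<phi>c [simp]: "\<phi> z \<in> carrier G" if "z \<in> carrier G" for z using \<phi> that by (auto simp: hom_def)
  have eq: "z \<otimes> h \<otimes> inv (\<phi> z) = id_minus G \<phi> z \<otimes> h"
    if "z \<in> carrier G" "h \<in> carrier G" for z h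
    using that by (simp add: id_minus_def m_ac)
  have inv_eq: "id_minus G \<phi> (inv z) = inv (id_minus G \<phi> z)" if "z \<in> carrier G" for z
    using group_hom.hom_inv[of G G "id_minus G \<phi>" z] id_minus_hom[OF \<phi>] that
    by (simp add: group_hom_def group_hom_axioms_def is_group)
  have idc [simp]: "id_minus G \<phi> z \<in> carrier G" if "z \<in> carrier G" for z
    using id_minus_hom[OF \<phi>] that by (auto simp: hom_def)
  show ?thesis
  proof (intro equalityI subsetI)
    fix h assume "h \<in> twisted_class G \<phi> g"
    then obtain z where z: "z \<in> carrier G" "h \<in> carrier G" "g = id_minus G \<phi> z \<otimes> h"
      by (auto simp: twisted_class_def twisted_conj_def eq)
    then have "h = id_minus G \<phi> (inv z) \<otimes> g"
      by (simp add: inv_eq m_assoc[symmetric])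
    then show "h \<in> id_minus G \<phi> ` carrier G #> g"
      using z(1) by (auto simp: r_coset_def)
  next
    fix h assume "h \<in> id_minus G \<phi> ` carrier G #> g"
    then obtain z where z: "z \<in> carrier G" "h = id_minus G \<phi> z \<otimes> g"
      by (auto simp: r_coset_def)
    then have "g = id_minus G \<phi> (inv z) \<otimes> h"
      using g by (simp add: inv_eq m_assoc[symmetric])
    then show "h \<in> twisted_class G \<phi> g"
      using z g eq[of "inv z" h] unfolding twisted_class_def twisted_conj_def
      by (auto intro!: bexI[of _ "inv z"])
  qed
qed

section \<open>The group structure of \<open>\<int>\<^sup>n\<close>\<close>

lemma carrier_Z_pow [simp]: "carrier (Z_pow n) = {..<n} \<rightarrow>\<^sub>E UNIV"
  by (simp add: Z_pow_def)

lemma mult_Z_pow [simp]: "x \<otimes>\<^bsub>Z_pow n\<^esub> y = (\<lambda>i\<in>{..<n}. x i + y i)"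
  by (simp add: Z_pow_def)

lemma one_Z_pow [simp]: "\<one>\<^bsub>Z_pow n\<^esub> = (\<lambda>i\<in>{..<n}. 0)"
  by (simp add: Z_pow_def)

lemma group_Z_pow: "group (Z_pow n)"
  by (simp add: Z_pow_def)

lemma comm_group_Z_pow: "comm_group (Z_pow n)"
  by (rule group.group_comm_groupI[OF group_Z_pow]) (auto simp: add.commute)

lemma inv_Z_pow [simp]:
  "x \<in> {..<n} \<rightarrow>\<^sub>E UNIV \<Longrightarrow> inv\<^bsub>Z_pow n\<^esub> x = (\<lambda>i\<in>{..<n}. - x i)"
  unfolding Z_pow_def by (subst inv_product_group) auto

lemma nat_pow_Z_pow:
  fixes k :: nat
  assumes "x \<in> carrier (Z_pow n)"
  shows "x [^]\<^bsub>Z_pow n\<^esub> k = (\<lambda>i\<in>{..<n}. int k * x i)"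
  by (induction k) (simp_all add: nat_pow_def fun_eq_iff algebra_simps)

lemma int_pow_Z_pow:
  fixes q :: int
  assumes "x \<in> carrier (Z_pow n)"
  shows "x [^]\<^bsub>Z_pow n\<^esub> q = (\<lambda>i\<in>{..<n}. q * x i)"
proof (cases "q < 0")
  case True
  have "(\<lambda>i\<in>{..<n}. int (nat (- q)) * x i) \<in> {..<n} \<rightarrow>\<^sub>E UNIV" by simp
  then show ?thesis
    using True by (simp add: int_pow_def2 nat_pow_Z_pow[OF assms] cong: restrict_cong)
next
  case False
  then show ?thesis by (simp add: int_pow_def2 nat_pow_Z_pow[OF assms])
qed

lemma subgroup_Z_pow_add_mult:
  assumes H: "subgroup H (Z_pow n)" and x: "x \<in> H" and y: "y \<in> H"
  shows "(\<lambda>i\<in>{..<n}. x i + q * y i) \<in> H"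
proof -
  have "y \<in> carrier (Z_pow n)" using subgroup.subset[OF H] y by blast
  then have "(\<lambda>i\<in>{..<n}. q * y i) \<in> H"
    using group.subgroup_int_pow_closed[OF group_Z_pow H y, of q] by (simp add: int_pow_Z_pow)
  then have "(\<lambda>i\<in>{..<n}. x i + (\<lambda>i\<in>{..<n}. q * y i) i) \<in> H"
    using subgroup.m_closed[OF H x, of "\<lambda>i\<in>{..<n}. q * y i"] by simp
  then show ?thesis by (simp cong: restrict_cong)
qed

lemma subgroup_Z_pow_extensional:
  "subgroup H (Z_pow n) \<Longrightarrow> h \<in> H \<Longrightarrow> h \<in> extensional {..<n}"
  using subgroup.subset[of H "Z_pow n"] by (auto simp: PiE_def)

section \<open>Echelon bases of subgroups of \<open>\<int>\<^sup>n\<close>\<close>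

definition pivots :: "nat \<Rightarrow> (nat \<Rightarrow> int) set \<Rightarrow> nat set"
  where "pivots n H = {i. i < n \<and> (\<exists>h\<in>H. h i \<noteq> 0 \<and> (\<forall>j<i. h j = 0))}"

text \<open>
  The divisibility clause is what makes such a family span over $\mathbb{Z}$ and not merely over
  $\mathbb{Q}$: it lets elimination cancel a leading entry with an integral multiple.
  The value of \<open>b\<close> outside the pivots is arbitrary.
\<close>

definition echelon_basis :: "nat \<Rightarrow> (nat \<Rightarrow> int) set \<Rightarrow> (nat \<Rightarrow> nat \<Rightarrow> int) \<Rightarrow> bool"
  where "echelon_basis n H b \<longleftrightarrow> (\<forall>i\<in>pivots n H.
     b i \<in> H \<and> (\<forall>j<i. b i j = 0) \<and> 0 < b i i \<and> (\<forall>h\<in>H. (\<forall>j<i. h j = 0) \<longrightarrow> b i i dvd h i))"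

lemma finite_pivots [simp]: "finite (pivots n H)"
  by (rule finite_subset[of _ "{..<n}"]) (auto simp: pivots_def)

lemma pivots_subset: "pivots n H \<subseteq> {..<n}"
  by (auto simp: pivots_def)

lemma echelon_basisD:
  assumes "echelon_basis n H b" "i \<in> pivots n H"
  shows "b i \<in> H" "\<And>j. j < i \<Longrightarrow> b i j = 0" "0 < b i i"
    "\<And>h. h \<in> H \<Longrightarrow> (\<And>j. j < i \<Longrightarrow> h j = 0) \<Longrightarrow> b i i dvd h i"
  using assms unfolding echelon_basis_def by auto

text \<open>
  For a pivot $i$, the entries $h_i$ of those $h \in H$ that vanish before $i$ form a nonzero ideal of
  $\mathbb{Z}$; a vector realising its least positive element is the required basis vector.
\<close>

lemma ex_echelon_basis:
  assumes H: "subgroup H (Z_pow n)"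
  obtains b where "echelon_basis n H b"
proof -
  have "\<exists>b. b \<in> H \<and> (\<forall>j<i. b j = 0) \<and> 0 < b i \<and> (\<forall>h\<in>H. (\<forall>j<i. h j = 0) \<longrightarrow> b i dvd h i)"
    if "i \<in> pivots n H" for i
  proof -
    from that obtain h where i: "i < n" and h: "h \<in> H" "h i \<noteq> 0" "\<forall>j<i. h j = 0"
      by (auto simp: pivots_def)
    define A where "A = {h \<in> H. (\<forall>j<i. h j = 0) \<and> 0 < h i}"
    have zero: "(\<lambda>i\<in>{..<n}. 0) \<in> H" using subgroup.one_closed[OF H] by simp
    \<comment> \<open>Multiplying by the sign of the leading entry makes that entry positive.\<close>
    have "(\<lambda>k\<in>{..<n}. (\<lambda>i\<in>{..<n}. 0) k + sgn (h i) * h k) \<in> A"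
      using subgroup_Z_pow_add_mult[OF H zero h(1), of "sgn (h i)"] h(2,3) i
      by (auto simp: A_def sgn_if)
    then obtain b where b: "b \<in> A" and min: "\<And>x. x \<in> A \<Longrightarrow> nat (b i) \<le> nat (x i)"
      using ex_has_least_nat[of "\<lambda>x. x \<in> A" _ "\<lambda>x. nat (x i)"] by blast
    have "b i dvd x i" if x: "x \<in> H" "\<forall>j<i. x j = 0" for x
    proof (rule ccontr)
      assume "\<not> b i dvd x i"
      \<comment> \<open>Otherwise the division remainder would be a smaller positive entry.\<close>
      define y where "y = (\<lambda>k\<in>{..<n}. x k + (- (x i div b i)) * b k)"
      have yi: "y i = x i mod b i" using i by (simp add: y_def minus_div_mult_eq_mod)
      have "y \<in> H" unfolding y_def using b x H by (intro subgroup_Z_pow_add_mult) (auto simp: A_def)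
      moreover have "y j = 0" if "j < i" for j using that i x b by (simp add: y_def A_def)
      moreover have "0 < y i" "y i < b i"
        using b \<open>\<not> b i dvd x i\<close> pos_mod_sign[of "b i" "x i"] pos_mod_bound[of "b i" "x i"]
        by (auto simp: yi A_def dvd_eq_mod_eq_0 simp del: pos_mod_sign pos_mod_bound)
      ultimately have "y \<in> A" by (simp add: A_def)
      then show False using min[of y] \<open>0 < y i\<close> \<open>y i < b i\<close> by simp
    qed
    then show ?thesis using b by (intro exI[of _ b]) (auto simp: A_def)
  qed
  then have "\<exists>b. echelon_basis n H b" unfolding echelon_basis_def by (intro bchoice ballI)
  then show ?thesis using that by blast
qed

section \<open>The rank of a subgroup is its number of pivots\<close>

text \<open>
  The coefficient families are finitely supported functions, the elements of
  \<^const>\<open>free_Abelian_group\<close>, because this map is to become the isomorphism from the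
  free abelian group on the pivots.
\<close>

definition combination :: "nat \<Rightarrow> nat set \<Rightarrow> (nat \<Rightarrow> nat \<Rightarrow> int) \<Rightarrow> (nat \<Rightarrow>\<^sub>0 int) \<Rightarrow> nat \<Rightarrow> int"
  where "combination n P b c = (\<lambda>j\<in>{..<n}. \<Sum>i\<in>P. Poly_Mapping.lookup c i * b i j)"

lemma combination_add:
  "combination n P b (c + d) = (\<lambda>j\<in>{..<n}. combination n P b c j + combination n P b d j)"
  by (auto simp: combination_def fun_eq_iff lookup_add sum.distrib algebra_simps)

lemma combination_in_subgroup:
  assumes H: "subgroup H (Z_pow n)" and "finite P" "\<And>i. i \<in> P \<Longrightarrow> b i \<in> H"
  shows "combination n P b c \<in> H"
  using assms(2,3)
proof (induction P)
  case empty
  show ?case using subgroup.one_closed[OF H] by (simp add: combination_def restrict_def)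
next
  case (insert i P)
  have "combination n (insert i P) b c
      = (\<lambda>j\<in>{..<n}. combination n P b c j + Poly_Mapping.lookup c i * b i j)"
    using insert.hyps by (auto simp: combination_def fun_eq_iff)
  also have "\<dots> \<in> H" using insert by (intro subgroup_Z_pow_add_mult[OF H]) auto
  finally show ?case .
qed

text \<open>
  At the least index $m$ with a nonzero coefficient, only the $m$-th basis vector contributes:
  the coefficients before $m$ vanish, and the basis vectors after $m$ are zero at position $m$.
\<close>

lemma echelon_basis_independent:
  assumes b: "echelon_basis n H b"
    and c: "Poly_Mapping.keys c \<subseteq> pivots n H"
    and zero: "\<And>j. j < n \<Longrightarrow> combination n (pivots n H) b c j = 0"
  shows "c = 0"
proof (rule ccontr)
  assume "c \<noteq> 0"
  then have ne: "Poly_Mapping.keys c \<noteq> {}" by simp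
  define m where "m = Min (Poly_Mapping.keys c)"
  have m: "m \<in> Poly_Mapping.keys c" unfolding m_def using ne by (intro Min_in) auto
  then have mP: "m \<in> pivots n H" using c by blast
  have "Poly_Mapping.lookup c i * b i m = 0" if "i \<in> pivots n H" "i \<noteq> m" for i
  proof (cases "i < m")
    case True
    then have "i \<notin> Poly_Mapping.keys c" unfolding m_def by (meson Min_le finite_keys not_le)
    then show ?thesis by (simp add: in_keys_iff)
  next
    case False
    then show ?thesis using echelon_basisD(2)[OF b that(1), of m] that(2) by simp
  qed
  then have "combination n (pivots n H) b c m = Poly_Mapping.lookup c m * b m m"
    using mP pivots_subset[of n H]
    by (subst combination_def) (auto simp: sum.remove[OF finite_pivots mP] intro!: sum.neutral)
  then show False
    using zero[of m] m mP pivots_subset[of n H] echelon_basisD(3)[OF b mP] by (auto simp: in_keys_iff)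
qed

text \<open>
  Elimination from left to right: if $h_m \neq 0$ is the leading entry, then $m$ is a pivot and a
  multiple of the $m$-th basis vector cancels $h_m$. The number $m$ of leading entries already known
  to vanish is the induction parameter, going down from $n$, where $h = 0$.
\<close>

lemma echelon_basis_spans:
  assumes H: "subgroup H (Z_pow n)" and b: "echelon_basis n H b"
    and "h \<in> H" "m \<le> n" "\<And>j. j < m \<Longrightarrow> h j = 0"
  shows "\<exists>c. Poly_Mapping.keys c \<subseteq> pivots n H \<and> combination n (pivots n H) b c = h"
  using assms(4,3,5)
proof (induction arbitrary: h rule: inc_induct)
  case base
  have "combination n (pivots n H) b 0 = h"
    using base subgroup_Z_pow_extensional[OF H base(1)]
    by (auto simp: combination_def fun_eq_iff extensional_def)
  then show ?case by (intro exI[of _ 0]) auto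
next
  case (step m)
  show ?case
  proof (cases "h m = 0")
    case True
    then show ?thesis using step.IH[OF step.prems(1)] step.prems(2) less_Suc_eq by auto
  next
    case False
    then have mP: "m \<in> pivots n H" using step by (auto simp: pivots_def)
    obtain q where q: "h m = b m m * q"
      using echelon_basisD(4)[OF b mP step.prems] by (auto elim: dvdE)
    define h' where "h' = (\<lambda>j\<in>{..<n}. h j + (- q) * b m j)"
    have "h' \<in> H" unfolding h'_def
      using step.prems(1) echelon_basisD(1)[OF b mP] by (intro subgroup_Z_pow_add_mult H) auto
    moreover have "h' j = 0" if "j < Suc m" for j
      using that step.hyps step.prems(2) echelon_basisD(2)[OF b mP, of j] q
      by (auto simp: h'_def less_Suc_eq)
    ultimately obtain c' where c': "Poly_Mapping.keys c' \<subseteq> pivots n H"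
        "combination n (pivots n H) b c' = h'"
      using step.IH by blast
    define c where "c = c' + Poly_Mapping.single m q"
    have "combination n (pivots n H) b (Poly_Mapping.single m q) = (\<lambda>j\<in>{..<n}. q * b m j)"
      using mP by (auto simp: combination_def fun_eq_iff lookup_single when_def if_distrib[of "\<lambda>x. x * _"] cong: if_cong)
    then have "combination n (pivots n H) b c = h"
      using subgroup_Z_pow_extensional[OF H step.prems(1)]
      by (auto simp: c_def combination_add c'(2) h'_def fun_eq_iff extensional_def)
    moreover have "Poly_Mapping.keys c \<subseteq> pivots n H"
      using c'(1) mP keys_add[of c' "Poly_Mapping.single m q"]
      by (auto simp: c_def split: if_splits)
    ultimately show ?thesis by blast
  qed
qed

lemma free_abelian_rank_subgroup:
  assumes H: "subgroup H (Z_pow n)"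
  shows "free_abelian_rank (Z_pow n\<lparr>carrier := H\<rparr>) = card (pivots n H)"
proof -
  obtain b where b: "echelon_basis n H b" using ex_echelon_basis[OF H] .
  define P where "P = pivots n H"
  define F where "F = combination n P b"
  let ?K = "Z_pow n\<lparr>carrier := H\<rparr>" and ?A = "free_Abelian_group P"
  have K: "group ?K" using subgroup.subgroup_is_group[OF H group_Z_pow] .
  have hom: "F \<in> hom ?A ?K"
    using combination_in_subgroup[OF H, of P b] echelon_basisD(1)[OF b]
    by (intro homI) (auto simp: F_def P_def combination_add)
  have "inj_on F (carrier ?A)"
  proof (rule inj_onI)
    fix c d assume cd: "c \<in> carrier ?A" "d \<in> carrier ?A" "F c = F d"
    have "combination n P b (c - d) j = 0" if "j < n" for j
      using fun_cong[OF cd(3), of j] combination_add[of n P b "c - d" d] that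
      by (simp add: F_def)
    then have "c - d = 0"
      using cd keys_diff[of c d] unfolding P_def by (intro echelon_basis_independent[OF b]) auto
    then show "c = d" by simp
  qed
  moreover have "F ` carrier ?A = carrier ?K"
  proof
    show "F ` carrier ?A \<subseteq> carrier ?K" using hom by (auto simp: hom_def)
    show "carrier ?K \<subseteq> F ` carrier ?A"
    proof
      fix h assume "h \<in> carrier ?K"
      then obtain c where "Poly_Mapping.keys c \<subseteq> P" "F c = h"
        using echelon_basis_spans[OF H b, of h 0] by (auto simp: F_def P_def)
      then show "h \<in> F ` carrier ?A" by auto
    qed
  qed
  ultimately have "F \<in> iso ?A ?K" using hom by (simp add: iso_def bij_betw_def)
  then have "?K \<cong> ?A" by (meson group.iso_sym group_free_Abelian_group is_isoI)
  moreover have "?A \<cong> free_Abelian_group {..<card P}"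
    by (simp add: isomorphic_free_Abelian_groups eqpoll_iff_card P_def)
  ultimately show ?thesis
    unfolding P_def[symmetric] using K by (intro free_abelian_rank_eqI) (auto intro: iso_trans)
qed

section \<open>Counting the cosets that meet a box\<close>

text \<open>
  The pivot coordinates are reduced one after another, from left to right. Treating position $m$
  subtracts \<open>q\<close> times \<open>b m\<close>, which is zero before $m$ and so keeps the earlier reductions. As the
  quotient \<open>q\<close> is bounded by the current entry at $m$, one step enlarges the sup norm at most by
  a factor that depends only on \<open>b m\<close>. The constant \<open>K\<close> therefore depends on \<open>b\<close> but not on $R$.
\<close>

lemma ex_reduced_representative:
  assumes H: "subgroup H (Z_pow n)" and b: "echelon_basis n H b"
  obtains K :: int where "K \<ge> 1"
    "\<And>x R. x \<in> carrier (Z_pow n) \<Longrightarrow> (\<And>i. i < n \<Longrightarrow> \<bar>x i\<bar> \<le> R) \<Longrightarrow>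
      \<exists>y \<in> H #>\<^bsub>Z_pow n\<^esub> x. (\<forall>i<n. \<bar>y i\<bar> \<le> K * R) \<and> (\<forall>i\<in>pivots n H. 0 \<le> y i \<and> y i < b i i)"
proof -
  have "\<exists>K::int\<ge>1. \<forall>x R. x \<in> carrier (Z_pow n) \<longrightarrow> (\<forall>i<n. \<bar>x i\<bar> \<le> R) \<longrightarrow>
      (\<exists>y \<in> H #>\<^bsub>Z_pow n\<^esub> x. (\<forall>i<n. \<bar>y i\<bar> \<le> K * R)
         \<and> (\<forall>i\<in>pivots n H. i < m \<longrightarrow> 0 \<le> y i \<and> y i < b i i))" for m
  proof (induction m)
    case 0
    show ?case
      using group.rcos_self[OF group_Z_pow _ H] by (intro exI[of _ 1]) auto
  next
    case (Suc m)
    then obtain K :: int where K: "K \<ge> 1" and red: "\<And>x R. x \<in> carrier (Z_pow n) \<Longrightarrow> \<forall>i<n. \<bar>x i\<bar> \<le> R \<Longrightarrow>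
      (\<exists>y \<in> H #>\<^bsub>Z_pow n\<^esub> x. (\<forall>i<n. \<bar>y i\<bar> \<le> K * R)
         \<and> (\<forall>i\<in>pivots n H. i < m \<longrightarrow> 0 \<le> y i \<and> y i < b i i))" by blast
    show ?case
    proof (cases "m \<in> pivots n H")
      case False
      then have "i \<in> pivots n H \<Longrightarrow> i < Suc m \<longleftrightarrow> i < m" for i
        by (cases "i = m") auto
      then show ?thesis using K red by (intro exI[of _ K]) (simp del: carrier_Z_pow)
    next
      case True
      have m: "m < n" using True pivots_subset by blast
      define C where "C = (\<Sum>i<n. \<bar>b m i\<bar>)"
      have C: "\<bar>b m i\<bar> \<le> C" if "i < n" for i
        unfolding C_def using that by (intro member_le_sum) auto
      have C0: "0 \<le> C" unfolding C_def by (intro sum_nonneg) auto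
      show ?thesis
      proof (intro exI[of _ "K * (1 + C)"] conjI allI impI)
        show "1 \<le> K * (1 + C)" using mult_mono[of 1 K 1 "1 + C"] K C0 by simp
        fix x R assume x: "x \<in> carrier (Z_pow n)" "\<forall>i<n. \<bar>x i\<bar> \<le> R"
        obtain y where y: "y \<in> H #>\<^bsub>Z_pow n\<^esub> x" "\<forall>i<n. \<bar>y i\<bar> \<le> K * R"
            "\<forall>i\<in>pivots n H. i < m \<longrightarrow> 0 \<le> y i \<and> y i < b i i"
          using red[OF x] by blast
        define q where "q = y m div b m m"
        define z where "z = (\<lambda>i\<in>{..<n}. y i + (- q) * b m i)"
        obtain h where h: "h \<in> H" "y = (\<lambda>i\<in>{..<n}. h i + x i)"
          using y(1) by (auto simp: r_coset_def)
        have bm: "0 < b m m" "b m \<in> H" using echelon_basisD[OF b True] by auto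
        have "z = (\<lambda>i\<in>{..<n}. h i + (- q) * b m i) \<otimes>\<^bsub>Z_pow n\<^esub> x"
          by (auto simp: z_def h(2) fun_eq_iff)
        moreover have "(\<lambda>i\<in>{..<n}. h i + (- q) * b m i) \<in> H"
          by (rule subgroup_Z_pow_add_mult[OF H h(1) bm(2)])
        ultimately have "z \<in> H #>\<^bsub>Z_pow n\<^esub> x" unfolding r_coset_def by blast
        moreover have "\<bar>z i\<bar> \<le> K * (1 + C) * R" if i: "i < n" for i
        proof -
          have "\<bar>q\<bar> \<le> \<bar>y m\<bar>"
            using bm(1) zdiv_mono2[of "y m" 1 "b m m"] zdiv_mono2_neg[of "y m" 1 "b m m"]
              pos_imp_zdiv_nonneg_iff[of "b m m" "y m"] pos_imp_zdiv_neg_iff[of "b m m" "y m"]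
            by (cases "y m < 0") (auto simp: q_def)
          then have q: "\<bar>q\<bar> \<le> K * R" using y(2) m by force
          have "\<bar>z i\<bar> \<le> \<bar>y i\<bar> + \<bar>q\<bar> * \<bar>b m i\<bar>"
            using i abs_triangle_ineq[of "y i" "- q * b m i"] by (simp add: z_def abs_mult)
          also have "\<dots> \<le> K * R + K * R * C"
            using y(2) i q C[OF i] by (intro add_mono mult_mono) auto
          finally show ?thesis by (simp add: algebra_simps)
        qed
        moreover have "0 \<le> z i \<and> z i < b i i" if i: "i \<in> pivots n H" "i < Suc m" for i
        proof (cases "i = m")
          case True
          then have "z i = y m mod b m m" using m by (simp add: z_def q_def minus_div_mult_eq_mod)
          then show ?thesis using bm True by simp
        next
          case False
          then have "z i = y i" using i m echelon_basisD(2)[OF b \<open>m \<in> pivots n H\<close>, of i] by (simp add: z_def)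
          then show ?thesis using y(3) i False by simp
        qed
        ultimately show "\<exists>y \<in> H #>\<^bsub>Z_pow n\<^esub> x. (\<forall>i<n. \<bar>y i\<bar> \<le> K * (1 + C) * R)
            \<and> (\<forall>i\<in>pivots n H. i < Suc m \<longrightarrow> 0 \<le> y i \<and> y i < b i i)"
          by blast
      qed
    qed
  qed
  from this[of n] obtain K :: int where "K \<ge> 1" and "\<forall>x R. x \<in> carrier (Z_pow n) \<longrightarrow> (\<forall>i<n. \<bar>x i\<bar> \<le> R) \<longrightarrow>
      (\<exists>y \<in> H #>\<^bsub>Z_pow n\<^esub> x. (\<forall>i<n. \<bar>y i\<bar> \<le> K * R)
         \<and> (\<forall>i\<in>pivots n H. i < n \<longrightarrow> 0 \<le> y i \<and> y i < b i i))" by blast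
  moreover have "i < n" if "i \<in> pivots n H" for i using that pivots_subset by blast
  ultimately show ?thesis by (intro that[of K]) simp_all
qed

text \<open>
  The product over the pivots of the leading coefficients, which is the constant \<open>C\<close>, counts the
  reduced pivot coordinates; each free coordinate has at most $2KR + 1$ values.
\<close>

lemma card_cosets_box_upper:
  assumes H: "subgroup H (Z_pow n)"
  obtains C K :: nat where
    "\<And>R :: nat. card ((#>\<^bsub>Z_pow n\<^esub>) H ` {x \<in> carrier (Z_pow n). \<forall>i<n. \<bar>x i\<bar> \<le> int R})
       \<le> C * (2 * K * R + 1) ^ (n - card (pivots n H))"
proof -
  obtain b where b: "echelon_basis n H b" using ex_echelon_basis[OF H] .
  obtain K :: int where K: "K \<ge> 1" and
    red: "\<And>x R. x \<in> carrier (Z_pow n) \<Longrightarrow> (\<And>i. i < n \<Longrightarrow> \<bar>x i\<bar> \<le> R) \<Longrightarrow>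
      \<exists>y \<in> H #>\<^bsub>Z_pow n\<^esub> x. (\<forall>i<n. \<bar>y i\<bar> \<le> K * R) \<and> (\<forall>i\<in>pivots n H. 0 \<le> y i \<and> y i < b i i)"
    using ex_reduced_representative[OF H b] by blast
  define P where "P = pivots n H"
  have P: "P \<subseteq> {..<n}" "finite P" using pivots_subset by (auto simp: P_def)
  define C where "C = (\<Prod>i\<in>P. nat (b i i))"
  have "card ((#>\<^bsub>Z_pow n\<^esub>) H ` {x \<in> carrier (Z_pow n). \<forall>i<n. \<bar>x i\<bar> \<le> int R})
       \<le> C * (2 * nat K * R + 1) ^ (n - card P)" for R :: nat
  proof -
    let ?X = "{x \<in> carrier (Z_pow n). \<forall>i<n. \<bar>x i\<bar> \<le> int R}"
    define A where "A = (\<lambda>i. if i \<in> P then {0..<b i i} else {- (K * int R)..K * int R})"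
    define Y where "Y = PiE {..<n} A"
    have finY: "finite Y" unfolding Y_def by (intro finite_PiE) (auto simp: A_def)
    have "(#>\<^bsub>Z_pow n\<^esub>) H ` ?X \<subseteq> (#>\<^bsub>Z_pow n\<^esub>) H ` Y"
    proof (rule image_subsetI)
      fix x assume x: "x \<in> ?X"
      then obtain y where y: "y \<in> H #>\<^bsub>Z_pow n\<^esub> x" "\<forall>i<n. \<bar>y i\<bar> \<le> K * int R"
          "\<forall>i\<in>P. 0 \<le> y i \<and> y i < b i i"
        using red[of x "int R"] unfolding P_def by blast
      have "y \<in> carrier (Z_pow n)"
        using y(1) by (auto simp: r_coset_def)
      then have "y \<in> Y" using y(2,3) by (auto simp: Y_def A_def PiE_iff abs_le_iff minus_le_iff)
      moreover have "H #>\<^bsub>Z_pow n\<^esub> x = H #>\<^bsub>Z_pow n\<^esub> y"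
        using group.repr_independence[OF group_Z_pow y(1) _ H] x by blast
      ultimately show "H #>\<^bsub>Z_pow n\<^esub> x \<in> (#>\<^bsub>Z_pow n\<^esub>) H ` Y" by blast
    qed
    then have "card ((#>\<^bsub>Z_pow n\<^esub>) H ` ?X) \<le> card Y"
      using finY by (meson card_image_le card_mono finite_imageI le_trans)
    also have "card Y = (\<Prod>i<n. card (A i))" unfolding Y_def by (simp add: card_PiE)
    also have "\<dots> = (\<Prod>i\<in>P. card (A i)) * (\<Prod>i\<in>{..<n} - P. card (A i))"
      using P prod.subset_diff[of P "{..<n}" "\<lambda>i. card (A i)"] by (simp add: mult.commute)
    also have "(\<Prod>i\<in>P. card (A i)) = C" unfolding C_def by (intro prod.cong) (auto simp: A_def)
    also have "(\<Prod>i\<in>{..<n} - P. card (A i)) = (\<Prod>i\<in>{..<n} - P. 2 * nat K * R + 1)"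
      using K by (intro prod.cong refl) (auto simp: A_def nat_add_distrib nat_mult_distrib)
    also have "\<dots> = (2 * nat K * R + 1) ^ (n - card P)"
      using P by (simp add: card_Diff_subset)
    finally show ?thesis .
  qed
  then show ?thesis using that P_def by blast
qed

text \<open>
  The vectors in the box that vanish at all pivots lie in pairwise distinct cosets, since the
  leading position of a nonzero element of \<open>H\<close> is a pivot.
\<close>

lemma card_cosets_box_lower:
  assumes H: "subgroup H (Z_pow n)"
    and fin: "finite B"
    and box: "\<And>x. x \<in> carrier (Z_pow n) \<Longrightarrow> (\<And>i. i < n \<Longrightarrow> 0 \<le> x i \<and> x i \<le> int t) \<Longrightarrow> x \<in> B"
  shows "(t + 1) ^ (n - card (pivots n H)) \<le> card ((#>\<^bsub>Z_pow n\<^esub>) H ` B)"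
proof -
  define P where "P = pivots n H"
  have P: "P \<subseteq> {..<n}" "finite P" using pivots_subset by (auto simp: P_def)
  define A where "A = (\<lambda>i. if i \<in> P then {0} else {0..int t})"
  define Y where "Y = PiE {..<n} A"
  have Y: "Y \<subseteq> carrier (Z_pow n)" unfolding Y_def by auto
  have "inj_on ((#>\<^bsub>Z_pow n\<^esub>) H) Y"
  proof (rule inj_onI)
    fix x y assume xy: "x \<in> Y" "y \<in> Y" "H #>\<^bsub>Z_pow n\<^esub> x = H #>\<^bsub>Z_pow n\<^esub> y"
    then have "x \<in> H #>\<^bsub>Z_pow n\<^esub> y"
      using group.rcos_self[OF group_Z_pow _ H, of x] Y by blast
    then obtain h where h: "h \<in> H" "x = (\<lambda>i\<in>{..<n}. h i + y i)"
      by (auto simp: r_coset_def)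
    \<comment> \<open>A first nonzero entry of \<open>h\<close> would sit at a pivot, where \<open>x\<close> and \<open>y\<close> agree.\<close>
    have "h i = 0" if "i < n" for i
      using that
    proof (induction i rule: less_induct)
      case (less i)
      show ?case
      proof (rule ccontr)
        assume "h i \<noteq> 0"
        then have iP: "i \<in> P" using less h(1) by (auto simp: P_def pivots_def)
        then have "x i = 0" "y i = 0" using xy(1,2) less.prems unfolding Y_def A_def by (auto dest!: PiE_mem)
        then show False using h(2) \<open>h i \<noteq> 0\<close> less.prems by simp
      qed
    qed
    then show "x = y" using h(2) xy(2) by (auto simp: Y_def fun_eq_iff PiE_iff extensional_def)
  qed
  then have "card ((#>\<^bsub>Z_pow n\<^esub>) H ` Y) = card Y" by (rule card_image)
  also have "\<dots> = (\<Prod>i<n. card (A i))" unfolding Y_def by (simp add: card_PiE)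
  also have "\<dots> = (\<Prod>i\<in>{..<n} - P. card (A i))"
    by (intro prod.mono_neutral_right) (auto simp: A_def)
  also have "\<dots> = (\<Prod>i\<in>{..<n} - P. t + 1)"
    by (intro prod.cong refl) (auto simp: A_def)
  also have "\<dots> = (t + 1) ^ (n - card P)"
    using P by (simp add: card_Diff_subset)
  finally have "card ((#>\<^bsub>Z_pow n\<^esub>) H ` Y) = (t + 1) ^ (n - card P)" .
  moreover have "Y \<subseteq> B"
  proof
    fix x assume x: "x \<in> Y"
    then have "0 \<le> x i \<and> x i \<le> int t" if "i < n" for i
      using PiE_mem[of x "{..<n}" A i] that unfolding Y_def A_def by (auto split: if_splits)
    then show "x \<in> B" using box x Y by blast
  qed
  then have "card ((#>\<^bsub>Z_pow n\<^esub>) H ` Y) \<le> card ((#>\<^bsub>Z_pow n\<^esub>) H ` B)"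
    using fin by (intro card_mono) auto
  ultimately show ?thesis by (simp add: P_def)
qed

section \<open>Balls and boxes in \<open>\<int>\<^sup>n\<close>\<close>

lemma ex_ball_in_box:
  assumes S: "fin_gen_set (Z_pow n) S"
  obtains M :: nat where
    "\<And>g i. g \<in> carrier (Z_pow n) \<Longrightarrow> i < n \<Longrightarrow> \<bar>g i\<bar> \<le> int (M * word_length (Z_pow n) S g)"
proof -
  have fin: "finite S" and sub: "S \<subseteq> carrier (Z_pow n)" using S by (auto simp: fin_gen_set_def)
  define M where "M = (\<Sum>s\<in>S. \<Sum>i<n. nat \<bar>s i\<bar>)"
  have M: "\<bar>s i\<bar> \<le> int M" if "s \<in> S" "i < n" for s i
  proof -
    have "nat \<bar>s i\<bar> \<le> (\<Sum>i<n. nat \<bar>s i\<bar>)" using that by (intro member_le_sum) auto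
    also have "\<dots> \<le> M" unfolding M_def using that fin by (intro member_le_sum) auto
    finally show ?thesis by simp
  qed
  have letter: "\<bar>s i\<bar> \<le> int M" if "s \<in> S \<union> m_inv (Z_pow n) ` S" "i < n" for s i
    using that M sub by auto
  have word: "\<bar>foldr (\<otimes>\<^bsub>Z_pow n\<^esub>) w \<one>\<^bsub>Z_pow n\<^esub> i\<bar> \<le> int (M * length w)"
    if "set w \<subseteq> S \<union> m_inv (Z_pow n) ` S" "i < n" for w i
    using that(1)
  proof (induction w)
    case Nil
    show ?case using that(2) by simp
  next
    case (Cons s w)
    then show ?case using letter[of s i] that(2) by (auto simp: algebra_simps)
  qed
  show ?thesis
  proof (rule that[of M])
    fix g i assume "g \<in> carrier (Z_pow n)" "i < n"
    then show "\<bar>g i\<bar> \<le> int (M * word_length (Z_pow n) S g)"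
      using group.word_length_attained[OF group_Z_pow S, of g] word by metis
  qed
qed

text \<open>
  A nonnegative vector is a product of powers of the standard basis vectors, so its length is at
  most the sum of its entries weighted by the lengths of these vectors. The positive orthant is
  enough because the lower bound counts only nonnegative vectors.
\<close>

lemma ex_box_in_ball:
  assumes S: "fin_gen_set (Z_pow n) S"
  obtains L :: nat where "L > 0"
    "\<And>x t. x \<in> carrier (Z_pow n) \<Longrightarrow> (\<And>i. i < n \<Longrightarrow> 0 \<le> x i \<and> x i \<le> int t)
       \<Longrightarrow> word_length (Z_pow n) S x \<le> L * t"
proof -
  interpret Z: group "Z_pow n" by (rule group_Z_pow)
  define e where "e = (\<lambda>k. \<lambda>i\<in>{..<n}. if i = k then 1 else 0 :: int)"
  have e: "e k \<in> carrier (Z_pow n)" for k by (auto simp: e_def)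
  let ?l = "word_length (Z_pow n) S"
  \<comment> \<open>Vectors supported on the first \<open>m\<close> coordinates, built up one coordinate at a time.\<close>
  have part: "?l x \<le> (\<Sum>k<m. ?l (e k)) * t"
    if "x \<in> carrier (Z_pow n)" "\<And>i. i < n \<Longrightarrow> 0 \<le> x i \<and> x i \<le> int t"
      "\<And>i. m \<le> i \<Longrightarrow> i < n \<Longrightarrow> x i = 0" "m \<le> n" for x t m
    using that
  proof (induction m arbitrary: x)
    case 0
    then have "x = \<one>\<^bsub>Z_pow n\<^esub>" by (auto simp: PiE_iff extensional_def fun_eq_iff)
    then show ?case by (simp only: word_length_one)
  next
    case (Suc m)
    define y where "y = x(m := 0)"
    have y: "y \<in> carrier (Z_pow n)" using Suc.prems(1,4) by (auto simp: y_def PiE_iff extensional_def)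
    have yl: "?l y \<le> (\<Sum>k<m. ?l (e k)) * t"
      using Suc.prems(2-4) by (intro Suc.IH y) (auto simp: y_def)
    have "0 \<le> x m" using Suc.prems(2)[of m] Suc.prems(4) by simp
    then have "e m [^]\<^bsub>Z_pow n\<^esub> nat (x m) = (\<lambda>i\<in>{..<n}. x m * e m i)"
      by (simp only: nat_pow_Z_pow[OF e] int_nat_eq if_True)
    then have "x = y \<otimes>\<^bsub>Z_pow n\<^esub> (e m [^]\<^bsub>Z_pow n\<^esub> nat (x m))"
      using Suc.prems(1,4)
      by (auto simp: y_def e_def PiE_iff extensional_def fun_eq_iff simp del: pow_nat)
    then have "?l x \<le> ?l y + ?l (e m [^]\<^bsub>Z_pow n\<^esub> nat (x m))"
      using Z.word_length_mult_le[OF S y Z.nat_pow_closed[OF e]] by metis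
    also have "\<dots> \<le> ?l y + nat (x m) * ?l (e m)"
      using Z.word_length_pow_le[OF S e] by simp
    also have "\<dots> \<le> (\<Sum>k<m. ?l (e k)) * t + t * ?l (e m)"
      using yl Suc.prems(2)[of m] Suc.prems(4) by (intro add_mono mult_right_mono) auto
    finally show ?case by (simp add: algebra_simps)
  qed
  \<comment> \<open>The successor keeps the constant positive when \<open>n = 0\<close>.\<close>
  show ?thesis
  proof (rule that[of "Suc (\<Sum>k<n. ?l (e k))"])
    fix x t assume "x \<in> carrier (Z_pow n)" "\<And>i. i < n \<Longrightarrow> 0 \<le> x i \<and> x i \<le> int t"
    then show "?l x \<le> Suc (\<Sum>k<n. ?l (e k)) * t"
      using part[of x t n] by simp
  qed simp
qed

lemma twisted_growth_eq_card_cosets: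
  assumes "\<phi> \<in> hom (Z_pow n) (Z_pow n)"
  shows "twisted_growth (Z_pow n) S \<phi> r
    = card ((#>\<^bsub>Z_pow n\<^esub>) (id_minus (Z_pow n) \<phi> ` carrier (Z_pow n)) ` word_ball (Z_pow n) S r)"
  unfolding twisted_growth_def
  by (intro arg_cong[where f = card] image_cong refl
      comm_group.twisted_class_eq_coset[OF comm_group_Z_pow assms]) (auto simp: word_ball_def)

section \<open>The growth rate\<close>

theorem theorem1:
  fixes n :: nat and S :: "(nat \<Rightarrow> int) set" and \<phi> :: "(nat \<Rightarrow> int) \<Rightarrow> (nat \<Rightarrow> int)"
  assumes "fin_gen_set (Z_pow n) S"
    and "\<phi> \<in> hom (Z_pow n) (Z_pow n)"
  shows "(\<lambda>r::real. real (twisted_growth (Z_pow n) S \<phi> r))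
           \<in> \<Theta>[at_top](\<lambda>r. r powr (real n - real (endo_rank (Z_pow n) (id_minus (Z_pow n) \<phi>))))"
proof -
  define H where "H = id_minus (Z_pow n) \<phi> ` carrier (Z_pow n)"
  have H: "subgroup H (Z_pow n)"
    unfolding H_def by (rule comm_group.subgroup_id_minus_image[OF comm_group_Z_pow assms(2)])
  define m where "m = n - card (pivots n H)"
  have "card (pivots n H) \<le> n"
    using card_mono[OF _ pivots_subset[of n H]] by simp
  then have m: "real n - real (endo_rank (Z_pow n) (id_minus (Z_pow n) \<phi>)) = real m"
    using free_abelian_rank_subgroup[OF H] by (simp add: m_def endo_rank_def H_def)
  let ?B = "word_ball (Z_pow n) S"
  let ?f = "\<lambda>r. card ((#>\<^bsub>Z_pow n\<^esub>) H ` ?B r)"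
  have f: "twisted_growth (Z_pow n) S \<phi> r = ?f r" for r
    unfolding H_def by (rule twisted_growth_eq_card_cosets[OF assms(2)])
  define cube where "cube = (\<lambda>R::nat. {x \<in> carrier (Z_pow n). \<forall>i<n. \<bar>x i\<bar> \<le> int R})"
  have fin_cube: "finite (cube R)" for R
  proof (rule finite_subset)
    show "cube R \<subseteq> {..<n} \<rightarrow>\<^sub>E {- int R..int R}"
      by (auto simp: cube_def PiE_iff abs_le_iff minus_le_iff extensional_def)
  qed (auto intro: finite_PiE)
  obtain M :: nat where M:
    "\<And>g i. g \<in> carrier (Z_pow n) \<Longrightarrow> i < n \<Longrightarrow> \<bar>g i\<bar> \<le> int (M * word_length (Z_pow n) S g)"
    using ex_ball_in_box[OF assms(1)] by blast
  obtain L :: nat where L: "L > 0" and box: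
    "\<And>x t. x \<in> carrier (Z_pow n) \<Longrightarrow> (\<And>i. i < n \<Longrightarrow> 0 \<le> x i \<and> x i \<le> int t)
       \<Longrightarrow> word_length (Z_pow n) S x \<le> L * t"
    using ex_box_in_ball[OF assms(1)] by blast
  obtain C K :: nat where upper: "\<And>R. card ((#>\<^bsub>Z_pow n\<^esub>) H ` cube R) \<le> C * (2 * K * R + 1) ^ m"
    using card_cosets_box_upper[OF H] unfolding cube_def m_def by blast
  have ball_cube: "?B r \<subseteq> cube (M * nat \<lfloor>r\<rfloor>)" for r
  proof
    fix g assume g: "g \<in> ?B r"
    then have gc: "g \<in> carrier (Z_pow n)" and "real (word_length (Z_pow n) S g) \<le> r"
      by (auto simp: word_ball_def)
    then have "M * word_length (Z_pow n) S g \<le> M * nat \<lfloor>r\<rfloor>" by (intro mult_left_mono) linarith+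
    then have "\<bar>g i\<bar> \<le> int (M * nat \<lfloor>r\<rfloor>)" if "i < n" for i
      using M[OF gc that] by linarith
    then show "g \<in> cube (M * nat \<lfloor>r\<rfloor>)" using gc by (simp add: cube_def)
  qed
  \<comment> \<open>The successor of \<open>C\<close> makes the upper constant visibly positive.\<close>
  have up: "real (?f r) \<le> real (Suc C * (2 * K * M + 1) ^ m) * r ^ m" if r: "r \<ge> 1" for r
  proof -
    define R where "R = M * nat \<lfloor>r\<rfloor>"
    have "real (nat \<lfloor>r\<rfloor>) \<le> r" using r by simp
    then have "2 * real K * real M * real (nat \<lfloor>r\<rfloor>) \<le> 2 * real K * real M * r"
      by (intro mult_left_mono) auto
    then have base: "real (2 * K * R + 1) \<le> (2 * K * M + 1) * r"
      using r by (simp add: R_def algebra_simps)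
    have "?f r \<le> card ((#>\<^bsub>Z_pow n\<^esub>) H ` cube R)"
      unfolding R_def using ball_cube fin_cube by (intro card_mono image_mono) auto
    also note upper[of R]
    finally have "real (?f r) \<le> real (C * (2 * K * R + 1) ^ m)"
      by (rule of_nat_mono)
    also have "\<dots> = real C * real (2 * K * R + 1) ^ m"
      by (simp only: of_nat_mult of_nat_power)
    also have "\<dots> \<le> real (Suc C) * ((2 * K * M + 1) * r) ^ m"
      using base by (intro mult_mono power_mono) auto
    finally show ?thesis by (simp only: power_mult_distrib of_nat_mult of_nat_power mult.assoc)
  qed
  have low: "(1 / real L) ^ m * r ^ m \<le> real (?f r)" if r: "r \<ge> 1" for r
  proof -
    \<comment> \<open>The largest \<open>t\<close> with \<open>L * t \<le> r\<close>, so that the ball contains the box \<open>[0, t]\<^sup>n\<close>.\<close>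
    define t where "t = nat \<lfloor>r / L\<rfloor>"
    have t: "real t \<le> r / L" "r / L \<le> real (t + 1)" using r L by (auto simp: t_def) linarith
    have tL: "real (L * t) \<le> r" using t(1) L by (simp add: field_simps)
    have "(t + 1) ^ m \<le> ?f r"
      unfolding m_def
    proof (rule card_cosets_box_lower[OF H])
      show "finite (?B r)" using ball_cube fin_cube finite_subset by blast
      fix x assume x: "x \<in> carrier (Z_pow n)" "\<And>i. i < n \<Longrightarrow> 0 \<le> x i \<and> x i \<le> int t"
      have "word_length (Z_pow n) S x \<le> L * t" using x by (rule box)
      then have "real (word_length (Z_pow n) S x) \<le> r" using tL by linarith
      then show "x \<in> ?B r" using x(1) by (simp add: word_ball_def)
    qed
    then have "real (t + 1) ^ m \<le> real (?f r)"
      by (simp only: of_nat_le_iff flip: of_nat_power)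
    moreover have "(r / L) ^ m \<le> real (t + 1) ^ m" using t(2) r by (intro power_mono) auto
    ultimately show ?thesis by (simp add: power_divide)
  qed
  show ?thesis
    unfolding m f
  proof (rule bigthetaI'[where ?c1.0 = "(1 / real L) ^ m" and ?c2.0 = "real (Suc C * (2 * K * M + 1) ^ m)"])
    show "\<forall>\<^sub>F r in at_top. (1 / real L) ^ m * norm (r powr real m) \<le> norm (real (?f r)) \<and>
        norm (real (?f r)) \<le> real (Suc C * (2 * K * M + 1) ^ m) * norm (r powr real m)"
      using eventually_ge_at_top[of "1::real"]
    proof eventually_elim
      case (elim r)
      then have norm_eq: "norm (r powr real m) = r ^ m" by (simp add: powr_realpow)
      show ?case unfolding norm_eq norm_of_nat using up[OF elim] low[OF elim] by blast
    qed
    show "0 < (1 / real L) ^ m" using L by simp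
    show "0 < real (Suc C * (2 * K * M + 1) ^ m)"
      by (simp only: of_nat_0_less_iff) simp
  qed
qed

end
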